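(* Let $k$ be a field, $n$ a positive integer and $R=(A_{ij})_{i,j=1,\dots,n}\in\mathcal{M}_{n^2}(k)\cong\mathcal{M}_n(k)\otimes\mathcal{M}_n(k)$ an invertible matrix, with blocks $A_{ij}\in\mathcal{M}_n(k)$, i.e. $R=\sum_{i,j=1}^n e_{ij}\otimes A_{ij}$. Then $R$ is a solution of the pentagon equation $R^{12}R^{13}R^{23}=R^{23}R^{12}$ if and only if $$\sum_{j=1}^n A_{ij}\otimes A_{jp}=R(A_{ip}\otimes I_n)R^{-1}$$ for all $i,p=1,\dots,n$.
   Context: $\mathcal{M}_n(k)$ is the algebra of $n\times n$ matrices, $e_{ij}$ the matrix with $1$ in position $(i,j)$ and $0$ elsewhere, $I_n$ the identity matrix. $\mathcal{M}_n(k)\otimes\mathcal{M}_n(k)$ is identified with $\mathcal{M}_{n^2}(k)$ via the Kronecker product: $A\otimes B$ is the block matrix with $(i,j)$ block $a_{ij}B$. For $R=\sum R^1\otimes R^2$, $R^{12}=\sum R^1\otimes R^2\otimes I_n$, $R^{13}=\sum R^1\otimes I_n\otimes R^2$, $R^{23}=\sum I_n\otimes R^1\otimes R^2$ in $\mathcal{M}_n(k)^{\otimes 3}$. *)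

theory Defs
  imports "Jordan_Normal_Form.Gauss_Jordan_Elimination"
begin

text \<open>
  Matrix positions are numbered from \<open>0\<close>, as in \<open>Jordan_Normal_Form.Matrix\<close>, so the index set
  \<open>1, \<dots>, n\<close> becomes \<open>0, \<dots>, n - 1\<close>.
\<close>

definition kron :: "'a :: semiring_1 mat \<Rightarrow> 'a mat \<Rightarrow> 'a mat" (infixl \<open>\<otimes>\<^sub>m\<close> 75) where
  "A \<otimes>\<^sub>m B = mat (dim_row A * dim_row B) (dim_col A * dim_col B)
     (\<lambda>(r, c). A $$ (r div dim_row B, c div dim_col B) * B $$ (r mod dim_row B, c mod dim_col B))"

definition unit_mat :: "nat \<Rightarrow> nat \<Rightarrow> nat \<Rightarrow> 'a :: semiring_1 mat" where
  "unit_mat n i j = mat n n (\<lambda>(r, c). if r = i \<and> c = j then 1 else 0)"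

text \<open>Finite sums of \<open>nr \<times> nc\<close> matrices; the analogue for matrices of \<^const>\<open>finsum_vec\<close>.\<close>

definition finsum_mat ::
  "'a :: monoid_add itself \<Rightarrow> nat \<Rightarrow> nat \<Rightarrow> ('c \<Rightarrow> 'a mat) \<Rightarrow> 'c set \<Rightarrow> 'a mat" where
  "finsum_mat ty nr nc = finprod (monoid_mat ty nr nc)"

text \<open>The block in position \<open>(i, j)\<close> of a matrix partitioned into \<open>n \<times> n\<close> blocks.\<close>

definition block :: "nat \<Rightarrow> 'a mat \<Rightarrow> nat \<Rightarrow> nat \<Rightarrow> 'a mat" where
  "block n R i j = mat n n (\<lambda>(r, c). R $$ (i * n + r, j * n + c))"

text \<open>
  \<open>R\<^sup>1\<^sup>2\<close>, \<open>R\<^sup>1\<^sup>3\<close>, \<open>R\<^sup>2\<^sup>3\<close> for \<open>R\<close> of size \<open>n\<^sup>2 \<times> n\<^sup>2\<close>. For \<open>R\<^sup>1\<^sup>3\<close> the decomposition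
  \<open>R = (\<Sum>i, j. e\<^sub>i\<^sub>j \<otimes> block\<^sub>i\<^sub>j)\<close> is used. The lemmas \<open>leg12_finsum\<close>, \<open>leg13_finsum\<close> and
  \<open>leg23_finsum\<close> below show that every decomposition of \<open>R\<close> into pure tensors gives
  the same result.
\<close>

definition leg12 :: "nat \<Rightarrow> 'a :: semiring_1 mat \<Rightarrow> 'a mat" where
  "leg12 n R = R \<otimes>\<^sub>m 1\<^sub>m n"

definition leg13 :: "nat \<Rightarrow> 'a :: semiring_1 mat \<Rightarrow> 'a mat" where
  "leg13 n R = finsum_mat TYPE('a) (n * n * n) (n * n * n)
     (\<lambda>(i, j). unit_mat n i j \<otimes>\<^sub>m 1\<^sub>m n \<otimes>\<^sub>m block n R i j) ({0..<n} \<times> {0..<n})"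

definition leg23 :: "nat \<Rightarrow> 'a :: semiring_1 mat \<Rightarrow> 'a mat" where
  "leg23 n R = 1\<^sub>m n \<otimes>\<^sub>m R"

definition pentagon_solution :: "nat \<Rightarrow> 'a :: semiring_1 mat \<Rightarrow> bool" where
  "pentagon_solution n R \<longleftrightarrow> leg12 n R * leg13 n R * leg23 n R = leg23 n R * leg12 n R"


lemma kron_carrier [simp]:
  "A \<in> carrier_mat a b \<Longrightarrow> B \<in> carrier_mat c d \<Longrightarrow> A \<otimes>\<^sub>m B \<in> carrier_mat (a * c) (b * d)"
  by (auto simp: kron_def)

lemma kron_dim [simp]:
  "dim_row (A \<otimes>\<^sub>m B) = dim_row A * dim_row B" "dim_col (A \<otimes>\<^sub>m B) = dim_col A * dim_col B"
  by (auto simp: kron_def)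

lemma kron_index:
  assumes "r < dim_row A * dim_row B" "c < dim_col A * dim_col B"
  shows "(A \<otimes>\<^sub>m B) $$ (r, c) =
    A $$ (r div dim_row B, c div dim_col B) * B $$ (r mod dim_row B, c mod dim_col B)"
  using assms by (auto simp: kron_def)

lemma unit_mat_carrier [simp]: "unit_mat n i j \<in> carrier_mat n n"
  by (simp add: unit_mat_def)

lemma block_carrier [simp]: "block n R i j \<in> carrier_mat n n"
  by (simp add: block_def)

lemma monoid_mat_simps:
  "mult (monoid_mat ty nr nc) = (+)"
  "carrier (monoid_mat ty nr nc) = carrier_mat nr nc"
  "one (monoid_mat ty nr nc) = 0\<^sub>m nr nc"
  by (simp_all add: monoid_mat_def)

lemmas finsum_mat_insert =
  comm_monoid.finprod_insert[OF comm_monoid_mat, folded finsum_mat_def, unfolded monoid_mat_simps]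

lemmas finsum_mat_closed =
  comm_monoid.finprod_closed[OF comm_monoid_mat, folded finsum_mat_def, unfolded monoid_mat_simps]

lemmas finsum_mat_empty =
  comm_monoid.finprod_empty[OF comm_monoid_mat, folded finsum_mat_def, unfolded monoid_mat_simps]

lemma index_finsum_mat:
  assumes "finite F" and "r < nr" "c < nc" and "f \<in> F \<rightarrow> carrier_mat nr nc"
  shows "finsum_mat TYPE('a :: comm_monoid_add) nr nc f F $$ (r, c) = (\<Sum>t\<in>F. f t $$ (r, c))"
  using assms(1,4)
proof (induct F)
  case (insert x F)
  hence f: "f \<in> F \<rightarrow> carrier_mat nr nc" "f x \<in> carrier_mat nr nc" by auto
  show ?case
    unfolding finsum_mat_insert[OF insert(1,2) f]
    using finsum_mat_closed[OF f(1)] f assms(2,3) insert by auto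
qed (use assms in \<open>auto simp: finsum_mat_empty\<close>)

lemma kron_assoc: "A \<otimes>\<^sub>m B \<otimes>\<^sub>m C = A \<otimes>\<^sub>m (B \<otimes>\<^sub>m C)"
proof (rule eq_matI, goal_cases)
  case (1 i j)
  hence b: "i < dim_row A * (dim_row B * dim_row C)" "j < dim_col A * (dim_col B * dim_col C)"
    by (auto simp: mult.assoc)
  hence pos: "dim_row B * dim_row C > 0" "dim_col B * dim_col C > 0"
    by (metis mult_0_right neq0_conv not_less0)+
  have d: "i div dim_row C < dim_row A * dim_row B" "j div dim_col C < dim_col A * dim_col B"
    using b by (auto simp: mult.assoc less_mult_imp_div_less)
  have m: "i mod (dim_row B * dim_row C) < dim_row B * dim_row C"
          "j mod (dim_col B * dim_col C) < dim_col B * dim_col C"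
    using pos by auto
  have pos': "dim_row C > 0" "dim_col C > 0" using pos by (auto intro: gr0I)
  show ?case
    using b d m pos' by (simp add: kron_index mult.assoc div_mult2_eq mod_mult2_eq
        mult.commute[of "dim_row B"] mult.commute[of "dim_col B"])
qed (auto simp: mult.assoc)

lemma finsum_kron_index:
  fixes R :: "'a :: semiring_1 mat"
  assumes "finite T" "F \<in> T \<rightarrow> carrier_mat n n" "G \<in> T \<rightarrow> carrier_mat n n"
    and R: "R = finsum_mat TYPE('a) (n * n) (n * n) (\<lambda>t. F t \<otimes>\<^sub>m G t) T"
    and "r < n * n" "c < n * n"
  shows "R $$ (r, c) = (\<Sum>t\<in>T. F t $$ (r div n, c div n) * G t $$ (r mod n, c mod n))"
proof -
  have FG: "F t \<in> carrier_mat n n" "G t \<in> carrier_mat n n" if "t \<in> T" for t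
    using assms that by auto
  have "R $$ (r, c) = (\<Sum>t\<in>T. (F t \<otimes>\<^sub>m G t) $$ (r, c))"
    unfolding R by (rule index_finsum_mat) (use assms FG in auto)
  also have "\<dots> = (\<Sum>t\<in>T. F t $$ (r div n, c div n) * G t $$ (r mod n, c mod n))"
  proof (rule sum.cong, rule refl)
    fix t assume "t \<in> T"
    then show "(F t \<otimes>\<^sub>m G t) $$ (r, c) = F t $$ (r div n, c div n) * G t $$ (r mod n, c mod n)"
      using FG[of t] assms(5,6) by (simp add: kron_index)
  qed
  finally show ?thesis .
qed

lemma finsum_block:
  fixes R :: "'a :: semiring_1 mat"
  assumes "R \<in> carrier_mat (n * n) (n * n)"
  shows "R = finsum_mat TYPE('a) (n * n) (n * n)
    (\<lambda>(i, j). unit_mat n i j \<otimes>\<^sub>m block n R i j) ({0..<n} \<times> {0..<n})" (is "_ = ?S")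
proof (rule eq_matI)
  have S: "?S \<in> carrier_mat (n * n) (n * n)" by (rule finsum_mat_closed) auto
  then show "dim_row R = dim_row ?S" "dim_col R = dim_col ?S" using assms by auto
  fix r c assume "r < dim_row ?S" "c < dim_col ?S"
  hence rc: "r < n * n" "c < n * n" using S by auto
  hence n: "n > 0" by (cases n) auto
  have d: "r div n < n" "c div n < n" using rc by (auto simp: less_mult_imp_div_less)
  have S': "?S = finsum_mat TYPE('a) (n * n) (n * n)
    (\<lambda>t. (case t of (i, j) \<Rightarrow> unit_mat n i j) \<otimes>\<^sub>m (case t of (i, j) \<Rightarrow> block n R i j))
    ({0..<n} \<times> {0..<n})" by (simp add: case_prod_beta')
  have "?S $$ (r, c) = (\<Sum>t\<in>{0..<n} \<times> {0..<n}.
      (case t of (i, j) \<Rightarrow> unit_mat n i j) $$ (r div n, c div n) *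
      (case t of (i, j) \<Rightarrow> block n R i j) $$ (r mod n, c mod n))"
    by (rule finsum_kron_index[OF _ _ _ S' rc]) auto
  also have "\<dots> = (\<Sum>t\<in>{0..<n} \<times> {0..<n}.
      if t = (r div n, c div n) then R $$ (r, c) else 0)"
    using n d by (intro sum.cong) (auto simp: unit_mat_def block_def split: if_splits)
  also have "\<dots> = R $$ (r, c)" using d by (simp add: sum.delta')
  finally show "R $$ (r, c) = ?S $$ (r, c)" ..
qed

lemma leg12_finsum:
  fixes R :: "'a :: semiring_1 mat"
  assumes "finite T" "F \<in> T \<rightarrow> carrier_mat n n" "G \<in> T \<rightarrow> carrier_mat n n"
    and R: "R = finsum_mat TYPE('a) (n * n) (n * n) (\<lambda>t. F t \<otimes>\<^sub>m G t) T"
  shows "leg12 n R = finsum_mat TYPE('a) (n * n * n) (n * n * n) (\<lambda>t. F t \<otimes>\<^sub>m G t \<otimes>\<^sub>m 1\<^sub>m n) T"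
    (is "_ = ?S")
proof (rule eq_matI)
  have FG: "F t \<in> carrier_mat n n" "G t \<in> carrier_mat n n" if "t \<in> T" for t
    using assms that by auto
  have S: "?S \<in> carrier_mat (n * n * n) (n * n * n)"
    by (rule finsum_mat_closed) (use FG in auto)
  have Rc: "R \<in> carrier_mat (n * n) (n * n)"
    unfolding R by (rule finsum_mat_closed) (use FG in auto)
  show "dim_row (leg12 n R) = dim_row ?S" "dim_col (leg12 n R) = dim_col ?S"
    using S Rc by (auto simp: leg12_def)
  fix r c assume "r < dim_row ?S" "c < dim_col ?S"
  hence rc: "r < n * n * n" "c < n * n * n" using S by auto
  have d: "r div n < n * n" "c div n < n * n" using rc by (auto simp: less_mult_imp_div_less)
  have "?S $$ (r, c) = (\<Sum>t\<in>T. (F t \<otimes>\<^sub>m G t \<otimes>\<^sub>m 1\<^sub>m n) $$ (r, c))"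
    by (rule index_finsum_mat) (use assms FG rc in auto)
  also have "\<dots> = (\<Sum>t\<in>T. F t $$ (r div n div n, c div n div n)
      * G t $$ (r div n mod n, c div n mod n)) * 1\<^sub>m n $$ (r mod n, c mod n)"
    unfolding sum_distrib_right
  proof (rule sum.cong, rule refl)
    fix t assume "t \<in> T"
    then show "(F t \<otimes>\<^sub>m G t \<otimes>\<^sub>m 1\<^sub>m n) $$ (r, c) = F t $$ (r div n div n, c div n div n)
      * G t $$ (r div n mod n, c div n mod n) * 1\<^sub>m n $$ (r mod n, c mod n)"
      using FG[of t] rc d by (simp add: kron_index)
  qed
  also have "\<dots> = R $$ (r div n, c div n) * 1\<^sub>m n $$ (r mod n, c mod n)"
    by (simp only: finsum_kron_index[OF assms d])
  also have "\<dots> = leg12 n R $$ (r, c)"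
    unfolding leg12_def using rc Rc by (simp add: kron_index)
  finally show "leg12 n R $$ (r, c) = ?S $$ (r, c)" ..
qed

lemma leg23_finsum:
  fixes R :: "'a :: semiring_1 mat"
  assumes "finite T" "F \<in> T \<rightarrow> carrier_mat n n" "G \<in> T \<rightarrow> carrier_mat n n"
    and R: "R = finsum_mat TYPE('a) (n * n) (n * n) (\<lambda>t. F t \<otimes>\<^sub>m G t) T"
  shows "leg23 n R = finsum_mat TYPE('a) (n * n * n) (n * n * n) (\<lambda>t. 1\<^sub>m n \<otimes>\<^sub>m F t \<otimes>\<^sub>m G t) T"
    (is "_ = ?S")
proof (rule eq_matI)
  have FG: "F t \<in> carrier_mat n n" "G t \<in> carrier_mat n n" if "t \<in> T" for t
    using assms that by auto
  have S: "?S \<in> carrier_mat (n * n * n) (n * n * n)"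
    by (rule finsum_mat_closed) (use FG in auto)
  have Rc: "R \<in> carrier_mat (n * n) (n * n)"
    unfolding R by (rule finsum_mat_closed) (use FG in auto)
  show "dim_row (leg23 n R) = dim_row ?S" "dim_col (leg23 n R) = dim_col ?S"
    using S Rc by (auto simp: leg23_def)
  fix r c assume "r < dim_row ?S" "c < dim_col ?S"
  hence rc: "r < n * (n * n)" "c < n * (n * n)" using S by (auto simp: mult.assoc)
  hence n: "n * n > 0" by (cases n) auto
  have d: "r mod (n * n) < n * n" "c mod (n * n) < n * n" using n by auto
  have "?S $$ (r, c) = (\<Sum>t\<in>T. (1\<^sub>m n \<otimes>\<^sub>m F t \<otimes>\<^sub>m G t) $$ (r, c))"
    by (rule index_finsum_mat) (use assms FG rc in \<open>auto simp: mult.assoc kron_assoc\<close>)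
  also have "\<dots> = 1\<^sub>m n $$ (r div (n * n), c div (n * n)) *
      (\<Sum>t\<in>T. F t $$ (r mod (n * n) div n, c mod (n * n) div n)
        * G t $$ (r mod (n * n) mod n, c mod (n * n) mod n))"
    unfolding sum_distrib_left
  proof (rule sum.cong, rule refl)
    fix t assume "t \<in> T"
    then show "(1\<^sub>m n \<otimes>\<^sub>m F t \<otimes>\<^sub>m G t) $$ (r, c) = 1\<^sub>m n $$ (r div (n * n), c div (n * n)) *
      (F t $$ (r mod (n * n) div n, c mod (n * n) div n)
        * G t $$ (r mod (n * n) mod n, c mod (n * n) mod n))"
      using FG[of t] rc d unfolding kron_assoc by (simp add: kron_index)
  qed
  also have "\<dots> = 1\<^sub>m n $$ (r div (n * n), c div (n * n)) * R $$ (r mod (n * n), c mod (n * n))"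
    by (simp only: finsum_kron_index[OF assms d])
  also have "\<dots> = leg23 n R $$ (r, c)"
    unfolding leg23_def using rc Rc by (simp add: kron_index)
  finally show "leg23 n R $$ (r, c) = ?S $$ (r, c)" ..
qed

lemma finsum_one_middle_index:
  fixes F :: "'c \<Rightarrow> 'a :: semiring_1 mat"
  assumes "finite T" "F \<in> T \<rightarrow> carrier_mat n n" "G \<in> T \<rightarrow> carrier_mat n n"
    and R: "R = finsum_mat TYPE('a) (n * n) (n * n) (\<lambda>t. F t \<otimes>\<^sub>m G t) T"
    and rc: "r < n * n * n" "c < n * n * n"
  shows "finsum_mat TYPE('a) (n * n * n) (n * n * n) (\<lambda>t. F t \<otimes>\<^sub>m 1\<^sub>m n \<otimes>\<^sub>m G t) T $$ (r, c) =
    (if r div n mod n = c div n mod n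
     then R $$ (r div n div n * n + r mod n, c div n div n * n + c mod n) else 0)"
proof -
  have FG: "F t \<in> carrier_mat n n" "G t \<in> carrier_mat n n" if "t \<in> T" for t
    using assms that by auto
  have n: "n > 0" using rc by (cases n) auto
  have d: "r div n < n * n" "c div n < n * n" using rc by (auto simp: less_mult_imp_div_less)
  have dd: "r div n div n < n" "c div n div n < n"
    using d by (auto simp: less_mult_imp_div_less)
  have lt: "a * n + b < n * n" if "a < n" "b < n" for a b
  proof -
    have "a * n + b < Suc a * n" using that by simp
    also have "\<dots> \<le> n * n" using that by (intro mult_le_mono1) auto
    finally show ?thesis .
  qed
  have e: "r div n div n * n + r mod n < n * n" "c div n div n * n + c mod n < n * n"
    using dd n by (auto intro!: lt)
  have "finsum_mat TYPE('a) (n * n * n) (n * n * n) (\<lambda>t. F t \<otimes>\<^sub>m 1\<^sub>m n \<otimes>\<^sub>m G t) T $$ (r, c)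
      = (\<Sum>t\<in>T. (F t \<otimes>\<^sub>m 1\<^sub>m n \<otimes>\<^sub>m G t) $$ (r, c))"
    by (rule index_finsum_mat) (use assms FG in auto)
  also have "\<dots> = (\<Sum>t\<in>T. if r div n mod n = c div n mod n
      then F t $$ (r div n div n, c div n div n) * G t $$ (r mod n, c mod n) else 0)"
  proof (rule sum.cong, rule refl)
    fix t assume "t \<in> T"
    then show "(F t \<otimes>\<^sub>m 1\<^sub>m n \<otimes>\<^sub>m G t) $$ (r, c) = (if r div n mod n = c div n mod n
      then F t $$ (r div n div n, c div n div n) * G t $$ (r mod n, c mod n) else 0)"
      using FG[of t] rc d n by (simp add: kron_index)
  qed
  also have "\<dots> = (if r div n mod n = c div n mod n
     then R $$ (r div n div n * n + r mod n, c div n div n * n + c mod n) else 0)"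
    using n by (simp add: finsum_kron_index[OF assms(1-4) e])
  finally show ?thesis .
qed

lemma leg13_finsum:
  fixes R :: "'a :: semiring_1 mat"
  assumes "finite T" "F \<in> T \<rightarrow> carrier_mat n n" "G \<in> T \<rightarrow> carrier_mat n n"
    and R: "R = finsum_mat TYPE('a) (n * n) (n * n) (\<lambda>t. F t \<otimes>\<^sub>m G t) T"
  shows "leg13 n R = finsum_mat TYPE('a) (n * n * n) (n * n * n) (\<lambda>t. F t \<otimes>\<^sub>m 1\<^sub>m n \<otimes>\<^sub>m G t) T"
    (is "_ = ?S")
proof (rule eq_matI)
  have FG: "F t \<in> carrier_mat n n" "G t \<in> carrier_mat n n" if "t \<in> T" for t
    using assms that by auto
  have S: "?S \<in> carrier_mat (n * n * n) (n * n * n)"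
    by (rule finsum_mat_closed) (use FG in auto)
  have L: "leg13 n R \<in> carrier_mat (n * n * n) (n * n * n)"
    unfolding leg13_def by (rule finsum_mat_closed) auto
  have Rc: "R \<in> carrier_mat (n * n) (n * n)"
    unfolding R by (rule finsum_mat_closed) (use FG in auto)
  show "dim_row (leg13 n R) = dim_row ?S" "dim_col (leg13 n R) = dim_col ?S"
    using S L by auto
  fix r c assume "r < dim_row ?S" "c < dim_col ?S"
  hence rc: "r < n * n * n" "c < n * n * n" using S by auto
  have R': "R = finsum_mat TYPE('a) (n * n) (n * n)
      (\<lambda>t. (case t of (i, j) \<Rightarrow> unit_mat n i j) \<otimes>\<^sub>m (case t of (i, j) \<Rightarrow> block n R i j))
      ({0..<n} \<times> {0..<n})"
    using finsum_block[OF Rc] by (simp add: case_prod_beta')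
  have L': "leg13 n R = finsum_mat TYPE('a) (n * n * n) (n * n * n)
      (\<lambda>t. (case t of (i, j) \<Rightarrow> unit_mat n i j) \<otimes>\<^sub>m 1\<^sub>m n \<otimes>\<^sub>m (case t of (i, j) \<Rightarrow> block n R i j))
      ({0..<n} \<times> {0..<n})"
    by (simp add: leg13_def case_prod_beta')
  have "leg13 n R $$ (r, c) = (if r div n mod n = c div n mod n
      then R $$ (r div n div n * n + r mod n, c div n div n * n + c mod n) else 0)"
    unfolding L' by (rule finsum_one_middle_index[OF _ _ _ R' rc]) auto
  also have "\<dots> = ?S $$ (r, c)"
    by (rule finsum_one_middle_index[OF assms rc, symmetric])
  finally show "leg13 n R $$ (r, c) = ?S $$ (r, c)" .
qed

end

theory Submission
  imports Defs
begin

text \<open>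
  View an \<open>n\<^sup>3 \<times> n\<^sup>3\<close> matrix as an \<open>n \<times> n\<close> array of blocks of size \<open>n\<^sup>2\<close>, the array coordinates being
  those of the first tensor factor. Since \<open>R = (\<Sum>i, j. e\<^sub>i\<^sub>j \<otimes> A\<^sub>i\<^sub>j)\<close>, the block \<open>(i, j)\<close> of
  \<open>R\<^sup>1\<^sup>2\<close> is \<open>A\<^sub>i\<^sub>j \<otimes> I\<close>, that of \<open>R\<^sup>1\<^sup>3\<close> is \<open>I \<otimes> A\<^sub>i\<^sub>j\<close>, and \<open>R\<^sup>2\<^sup>3\<close> is block diagonal with
  \<open>R\<close> in every diagonal position (\<open>block_leg12\<close>, \<open>block_leg13\<close>, \<open>block_kron_one_times\<close>). Blocks
  multiply like entries (\<open>block_times\<close>), and \<open>(A \<otimes> I)(I \<otimes> B) = A \<otimes> B\<close>, so the block \<open>(i, p)\<close> of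
  the left side of the pentagon equation is \<open>(\<Sum>j. A\<^sub>i\<^sub>j \<otimes> A\<^sub>j\<^sub>p) R\<close> and that of the right side is
  \<open>R (A\<^sub>i\<^sub>p \<otimes> I)\<close>. Comparing blocks and cancelling the invertible \<open>R\<close> on the right gives the
  equivalence.
\<close>

section \<open>Block coordinates\<close>

lemma block_position_less:
  fixes i n r m :: nat
  assumes "i < n" "r < m"
  shows "i * m + r < n * m"
proof -
  have "i * m + r < Suc i * m" using assms by simp
  also have "\<dots> \<le> n * m" using assms by (intro mult_le_mono1) auto
  finally show ?thesis .
qed

lemma sum_over_blocks:
  "(\<Sum>l\<in>{0..<n * m}. f l) = (\<Sum>j\<in>{0..<n}. \<Sum>k\<in>{0..<m}. f (j * m + k :: nat))"
proof -
  have "(\<Sum>l\<in>{0..<n * m}. f l) = (\<Sum>j<n. sum f {j * m..<j * m + m})"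
    by (simp only: sum.nat_group atLeast0LessThan)
  also have "\<dots> = (\<Sum>j\<in>{0..<n}. \<Sum>k\<in>{0..<m}. f (j * m + k))"
    by (simp only: sum.atLeastLessThan_shift_0[of f] atLeast0LessThan add_diff_cancel_left' o_def)
  finally show ?thesis .
qed

lemma finsum_mat_cong:
  assumes "S = T" "\<And>t. t \<in> T \<Longrightarrow> f t = g t" "\<And>t. t \<in> T \<Longrightarrow> g t \<in> carrier_mat nr nc"
  shows "finsum_mat TYPE('a :: comm_monoid_add) nr nc f S = finsum_mat TYPE('a) nr nc g T"
  unfolding finsum_mat_def
  by (rule comm_monoid.finprod_cong'[OF comm_monoid_mat])
    (use assms in \<open>auto simp: monoid_mat_simps\<close>)

lemma finsum_mat_single:
  assumes "i \<in> T" "finite T" "f i \<in> carrier_mat nr nc" "\<And>t. t \<in> T \<Longrightarrow> t \<noteq> i \<Longrightarrow> f t = 0\<^sub>m nr nc"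
  shows "finsum_mat TYPE('a :: comm_monoid_add) nr nc f T = f i"
proof -
  have f: "f \<in> T \<rightarrow> carrier_mat nr nc"
    using assms by (metis Pi_I zero_carrier_mat)
  have S: "finsum_mat TYPE('a) nr nc f T \<in> carrier_mat nr nc"
    by (rule finsum_mat_closed[OF f])
  show ?thesis
  proof (rule eq_matI)
    fix r c assume "r < dim_row (f i)" "c < dim_col (f i)"
    hence rc: "r < nr" "c < nc" using assms(3) by auto
    have "finsum_mat TYPE('a) nr nc f T $$ (r, c) = (\<Sum>t\<in>T. f t $$ (r, c))"
      by (rule index_finsum_mat[OF assms(2) rc f])
    also have "\<dots> = (\<Sum>t\<in>T. if t = i then f i $$ (r, c) else 0)"
      by (rule sum.cong) (use assms(4) rc in auto)
    also have "\<dots> = f i $$ (r, c)" using assms(1,2) by simp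
    finally show "finsum_mat TYPE('a) nr nc f T $$ (r, c) = f i $$ (r, c)" .
  qed (use S assms(3) in auto)
qed

lemma eq_iff_blocks_eq:
  assumes "M \<in> carrier_mat (n * m) (n * m)" "N \<in> carrier_mat (n * m) (n * m)"
  shows "M = N \<longleftrightarrow> (\<forall>i<n. \<forall>j<n. block m M i j = block m N i j)"
proof
  assume eq: "\<forall>i<n. \<forall>j<n. block m M i j = block m N i j"
  show "M = N"
  proof (rule eq_matI)
    fix r c assume "r < dim_row N" "c < dim_col N"
    hence rc: "r < n * m" "c < n * m" using assms by auto
    hence m: "m > 0" by (cases m) auto
    have d: "r div m < n" "c div m < n" using rc by (auto simp: less_mult_imp_div_less)
    hence "block m M (r div m) (c div m) $$ (r mod m, c mod m)
      = block m N (r div m) (c div m) $$ (r mod m, c mod m)"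
      using eq by simp
    thus "M $$ (r, c) = N $$ (r, c)" using m by (simp add: block_def)
  qed (use assms in auto)
qed simp

text \<open>
  The sum over the \<open>n m\<close> inner positions of the product splits into a sum over the \<open>n\<close> blocks and,
  inside each, a sum over its \<open>m\<close> positions; the latter is an entry of a product of two blocks.
\<close>

lemma block_times:
  fixes M N :: "'a :: comm_semiring_1 mat"
  assumes M: "M \<in> carrier_mat (n * m) (n * m)" and N: "N \<in> carrier_mat (n * m) (n * m)"
    and ip: "i < n" "p < n"
  shows "block m (M * N) i p =
    finsum_mat TYPE('a) m m (\<lambda>j. block m M i j * block m N j p) {0..<n}" (is "_ = ?S")
proof (rule eq_matI)
  have c: "(\<lambda>j. block m M i j * block m N j p) \<in> {0..<n} \<rightarrow> carrier_mat m m"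
    by (auto intro!: mult_carrier_mat[of _ m m])
  have S: "?S \<in> carrier_mat m m" by (rule finsum_mat_closed[OF c])
  show "dim_row (block m (M * N) i p) = dim_row ?S" "dim_col (block m (M * N) i p) = dim_col ?S"
    using S by (auto simp: block_def)
  fix r s assume "r < dim_row ?S" "s < dim_col ?S"
  hence rs: "r < m" "s < m" using S by auto
  note pos = block_position_less[OF ip(1) rs(1)] block_position_less[OF ip(2) rs(2)]
  have "block m (M * N) i p $$ (r, s)
      = (\<Sum>l\<in>{0..<n * m}. M $$ (i * m + r, l) * N $$ (l, p * m + s))"
    using M N rs pos by (simp add: block_def scalar_prod_def)
  also have "\<dots> = (\<Sum>j\<in>{0..<n}. (block m M i j * block m N j p) $$ (r, s))"
    unfolding sum_over_blocks using rs by (simp add: block_def scalar_prod_def)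
  also have "\<dots> = ?S $$ (r, s)" by (rule index_finsum_mat[OF _ rs c, symmetric]) simp
  finally show "block m (M * N) i p $$ (r, s) = ?S $$ (r, s)" .
qed

section \<open>Blocks of Kronecker products\<close>

text \<open>
  Splitting the inner index into block and position turns the entry of the left side into a double
  sum of products that separates into an \<open>A, C\<close> sum times a \<open>B, D\<close> sum. The separation moves
  \<open>C\<close> past \<open>B\<close>, hence the commutative scalars.
\<close>

lemma kron_mixed_product:
  fixes A B C D :: "'a :: comm_semiring_1 mat"
  assumes A: "A \<in> carrier_mat a b" and C: "C \<in> carrier_mat b c"
    and B: "B \<in> carrier_mat a' b'" and D: "D \<in> carrier_mat b' c'"
  shows "(A \<otimes>\<^sub>m B) * (C \<otimes>\<^sub>m D) = (A * C) \<otimes>\<^sub>m (B * D)" (is "?L = ?R")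
proof (rule eq_matI)
  fix r s assume "r < dim_row ?R" "s < dim_col ?R"
  hence rs: "r < a * a'" "s < c * c'" using assms by auto
  hence "a' > 0" "c' > 0" by (auto intro: gr0I)
  hence m: "r mod a' < a'" "s mod c' < c'" by auto
  have d: "r div a' < a" "s div c' < c" using rs by (auto simp: less_mult_imp_div_less)
  have "?L $$ (r, s) = (\<Sum>l\<in>{0..<b * b'}. (A \<otimes>\<^sub>m B) $$ (r, l) * (C \<otimes>\<^sub>m D) $$ (l, s))"
    using assms rs by (simp add: scalar_prod_def)
  also have "\<dots> = (\<Sum>j\<in>{0..<b}. \<Sum>k\<in>{0..<b'}.
      (A $$ (r div a', j) * C $$ (j, s div c')) * (B $$ (r mod a', k) * D $$ (k, s mod c')))"
    unfolding sum_over_blocks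
  proof (intro sum.cong refl)
    fix j k assume "j \<in> {0..<b}" "k \<in> {0..<b'}"
    hence jk: "j < b" "k < b'" by auto
    show "(A \<otimes>\<^sub>m B) $$ (r, j * b' + k) * (C \<otimes>\<^sub>m D) $$ (j * b' + k, s) =
      (A $$ (r div a', j) * C $$ (j, s div c')) * (B $$ (r mod a', k) * D $$ (k, s mod c'))"
      using assms rs jk block_position_less[OF jk] by (simp add: kron_index ac_simps)
  qed
  also have "\<dots> = (A * C) $$ (r div a', s div c') * (B * D) $$ (r mod a', s mod c')"
    using assms d m by (simp add: scalar_prod_def sum_product)
  also have "\<dots> = ?R $$ (r, s)" using assms rs by (simp add: kron_index)
  finally show "?L $$ (r, s) = ?R $$ (r, s)" .
qed (use assms in auto)

lemma block_kron:
  assumes "A \<in> carrier_mat n n" "B \<in> carrier_mat m m" "i < n" "j < n"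
  shows "block m (A \<otimes>\<^sub>m B) i j = A $$ (i, j) \<cdot>\<^sub>m B"
  by (rule eq_matI)
    (use assms in \<open>auto simp: block_def kron_index block_position_less\<close>)

text \<open>
  Associativity of the tensor product seen in coordinates: a coarse block of \<open>M \<otimes> B\<close> collects the
  positions whose first coordinates are \<open>(i, j)\<close>, which only restricts \<open>M\<close>.
\<close>

lemma block_kron_right:
  assumes M: "M \<in> carrier_mat (n * m) (n * m)" and B: "B \<in> carrier_mat l l" and ij: "i < n" "j < n"
  shows "block (m * l) (M \<otimes>\<^sub>m B) i j = block m M i j \<otimes>\<^sub>m B" (is "?L = ?R")
proof (rule eq_matI)
  fix r s assume "r < dim_row ?R" "s < dim_col ?R"
  hence rs: "r < m * l" "s < m * l" using B by (auto simp: block_def)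
  hence l: "l > 0" by (auto intro: gr0I)
  have d: "r div l < m" "s div l < m" using rs by (auto simp: less_mult_imp_div_less)
  have split: "(k * (m * l) + t) div l = k * m + t div l" "(k * (m * l) + t) mod l = t mod l"
    for k t :: nat
  proof -
    have *: "k * (m * l) + t = t + k * m * l" by simp
    show "(k * (m * l) + t) div l = k * m + t div l" "(k * (m * l) + t) mod l = t mod l"
      unfolding * using l by simp_all
  qed
  have pos: "i * (m * l) + r < n * m * l" "j * (m * l) + s < n * m * l"
    using block_position_less[OF ij(1) rs(1)] block_position_less[OF ij(2) rs(2)]
    by (simp_all add: mult.assoc)
  show "?L $$ (r, s) = ?R $$ (r, s)"
    using M B rs d pos by (simp add: block_def kron_index split)
qed (use B in \<open>auto simp: block_def\<close>)

text \<open>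
  Each \<open>e\<^sub>a\<^sub>b \<otimes> X\<^sub>a\<^sub>b\<close> is supported in the single block \<open>(a, b)\<close>. This is used twice: with \<open>m = n\<close>
  it recovers the given \<open>A\<^sub>i\<^sub>j\<close> from \<open>R\<close>, with \<open>m = n\<^sup>2\<close> it computes the blocks of \<open>R\<^sup>1\<^sup>3\<close>.
\<close>

lemma block_finsum_unit_mat:
  fixes X :: "nat \<Rightarrow> nat \<Rightarrow> 'a :: semiring_1 mat"
  assumes X: "\<And>i j. i < n \<Longrightarrow> j < n \<Longrightarrow> X i j \<in> carrier_mat m m" and ij: "i < n" "j < n"
  shows "block m (finsum_mat TYPE('a) (n * m) (n * m)
    (\<lambda>(i, j). unit_mat n i j \<otimes>\<^sub>m X i j) ({0..<n} \<times> {0..<n})) i j = X i j"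
    (is "block m (finsum_mat _ _ _ ?f ?T) i j = _")
proof (rule eq_matI)
  have f: "?f \<in> ?T \<rightarrow> carrier_mat (n * m) (n * m)" using X by auto
  fix r s assume "r < dim_row (X i j)" "s < dim_col (X i j)"
  hence rs: "r < m" "s < m" using X[OF ij] by auto
  note pos = block_position_less[OF ij(1) rs(1)] block_position_less[OF ij(2) rs(2)]
  have "block m (finsum_mat TYPE('a) (n * m) (n * m) ?f ?T) i j $$ (r, s)
      = (\<Sum>t\<in>?T. ?f t $$ (i * m + r, j * m + s))"
    using rs index_finsum_mat[OF _ pos f] by (simp add: block_def)
  also have "\<dots> = (\<Sum>t\<in>?T. if t = (i, j) then X i j $$ (r, s) else 0)"
  proof (rule sum.cong, rule refl)
    fix t assume "t \<in> ?T"
    then obtain a b where t: "t = (a, b)" and ab: "a < n" "b < n" by auto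
    have "?f t $$ (i * m + r, j * m + s) = block m (unit_mat n a b \<otimes>\<^sub>m X a b) i j $$ (r, s)"
      using rs by (simp add: block_def t)
    also have "\<dots> = (unit_mat n a b $$ (i, j) \<cdot>\<^sub>m X a b) $$ (r, s)"
      using block_kron[OF unit_mat_carrier X[OF ab] ij] by simp
    also have "\<dots> = (if t = (i, j) then X i j $$ (r, s) else 0)"
      using ij rs X[OF ab] by (auto simp: t unit_mat_def)
    finally show "?f t $$ (i * m + r, j * m + s) = (if t = (i, j) then X i j $$ (r, s) else 0)" .
  qed
  also have "\<dots> = X i j $$ (r, s)" using ij by simp
  finally show "block m (finsum_mat TYPE('a) (n * m) (n * m) ?f ?T) i j $$ (r, s) = X i j $$ (r, s)" .
qed (use X[OF ij] in \<open>auto simp: block_def\<close>)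

text \<open>\<open>I \<otimes> B\<close> is block diagonal, so it acts blockwise on either side.\<close>

lemma block_kron_one_times:
  fixes M :: "'a :: comm_semiring_1 mat"
  assumes M: "M \<in> carrier_mat (n * m) (n * m)" and B: "B \<in> carrier_mat m m" and ip: "i < n" "p < n"
  shows "block m ((1\<^sub>m n \<otimes>\<^sub>m B) * M) i p = B * block m M i p"
    and "block m (M * (1\<^sub>m n \<otimes>\<^sub>m B)) i p = block m M i p * B"
proof -
  have D: "1\<^sub>m n \<otimes>\<^sub>m B \<in> carrier_mat (n * m) (n * m)" using B by simp
  have diag: "block m (1\<^sub>m n \<otimes>\<^sub>m B) j j = B" if "j < n" for j
    using block_kron[OF one_carrier_mat B that that] that by auto
  have off: "block m (1\<^sub>m n \<otimes>\<^sub>m B) j k = 0\<^sub>m m m" if "j < n" "k < n" "j \<noteq> k" for j k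
    using block_kron[OF one_carrier_mat B that(1,2)] that B by auto
  have "block m ((1\<^sub>m n \<otimes>\<^sub>m B) * M) i p = block m (1\<^sub>m n \<otimes>\<^sub>m B) i i * block m M i p"
    unfolding block_times[OF D M ip]
    by (rule finsum_mat_single)
      (use ip off in \<open>auto intro!: mult_carrier_mat[of _ m m] left_mult_zero_mat\<close>)
  then show "block m ((1\<^sub>m n \<otimes>\<^sub>m B) * M) i p = B * block m M i p"
    using diag ip by simp
  have "block m (M * (1\<^sub>m n \<otimes>\<^sub>m B)) i p = block m M i p * block m (1\<^sub>m n \<otimes>\<^sub>m B) p p"
    unfolding block_times[OF M D ip]
    by (rule finsum_mat_single)
      (use ip off in \<open>auto intro!: mult_carrier_mat[of _ m m] right_mult_zero_mat\<close>)
  then show "block m (M * (1\<^sub>m n \<otimes>\<^sub>m B)) i p = block m M i p * B"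
    using diag ip by simp
qed

section \<open>The pentagon equation block by block\<close>

lemma leg_carrier:
  assumes "R \<in> carrier_mat (n * n) (n * n)"
  shows "leg12 n R \<in> carrier_mat (n * (n * n)) (n * (n * n))"
    and "leg13 n R \<in> carrier_mat (n * (n * n)) (n * (n * n))"
    and "leg23 n R \<in> carrier_mat (n * (n * n)) (n * (n * n))"
proof -
  show "leg12 n R \<in> carrier_mat (n * (n * n)) (n * (n * n))"
    using kron_carrier[OF assms one_carrier_mat[of n]] by (simp add: leg12_def mult.assoc)
  show "leg13 n R \<in> carrier_mat (n * (n * n)) (n * (n * n))"
    unfolding leg13_def mult.assoc[symmetric] by (rule finsum_mat_closed) auto
  show "leg23 n R \<in> carrier_mat (n * (n * n)) (n * (n * n))"
    using assms by (simp add: leg23_def)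
qed

lemma block_leg12:
  assumes "R \<in> carrier_mat (n * n) (n * n)" "i < n" "j < n"
  shows "block (n * n) (leg12 n R) i j = block n R i j \<otimes>\<^sub>m 1\<^sub>m n"
  unfolding leg12_def by (rule block_kron_right) (use assms in auto)

lemma block_leg13:
  assumes "i < n" "j < n"
  shows "block (n * n) (leg13 n R) i j = 1\<^sub>m n \<otimes>\<^sub>m block n R i j"
  unfolding leg13_def kron_assoc mult.assoc
  by (rule block_finsum_unit_mat) (use assms in auto)

lemma block_leg12_leg13:
  fixes R :: "'a :: comm_semiring_1 mat"
  assumes R: "R \<in> carrier_mat (n * n) (n * n)" and ip: "i < n" "p < n"
  shows "block (n * n) (leg12 n R * leg13 n R) i p =
    finsum_mat TYPE('a) (n * n) (n * n) (\<lambda>j. block n R i j \<otimes>\<^sub>m block n R j p) {0..<n}"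
  unfolding block_times[OF leg_carrier(1)[OF R] leg_carrier(2)[OF R] ip]
proof (rule finsum_mat_cong[OF refl])
  fix j assume j: "j \<in> {0..<n}"
  show "block (n * n) (leg12 n R) i j * block (n * n) (leg13 n R) j p =
      block n R i j \<otimes>\<^sub>m block n R j p"
    using j ip R kron_mixed_product[OF block_carrier one_carrier_mat one_carrier_mat block_carrier,
        of n R i j n R j p]
    by (simp add: block_leg12 block_leg13
        right_mult_one_mat[OF block_carrier] left_mult_one_mat[OF block_carrier])
qed auto

lemma pentagon_solution_iff_blocks:
  fixes R :: "'a :: comm_semiring_1 mat"
  assumes R: "R \<in> carrier_mat (n * n) (n * n)"
  shows "pentagon_solution n R \<longleftrightarrow> (\<forall>i<n. \<forall>p<n.
    finsum_mat TYPE('a) (n * n) (n * n) (\<lambda>j. block n R i j \<otimes>\<^sub>m block n R j p) {0..<n} * R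
      = R * (block n R i p \<otimes>\<^sub>m 1\<^sub>m n))"
proof -
  note L = leg_carrier[OF R]
  have "leg12 n R * leg13 n R * leg23 n R \<in> carrier_mat (n * (n * n)) (n * (n * n))"
    and "leg23 n R * leg12 n R \<in> carrier_mat (n * (n * n)) (n * (n * n))"
    using L by (metis mult_carrier_mat)+
  from eq_iff_blocks_eq[OF this]
  have "pentagon_solution n R \<longleftrightarrow> (\<forall>i<n. \<forall>p<n.
    block (n * n) (leg12 n R * leg13 n R * leg23 n R) i p
      = block (n * n) (leg23 n R * leg12 n R) i p)"
    by (simp add: pentagon_solution_def)
  moreover have "block (n * n) (leg12 n R * leg13 n R * leg23 n R) i p =
      finsum_mat TYPE('a) (n * n) (n * n) (\<lambda>j. block n R i j \<otimes>\<^sub>m block n R j p) {0..<n} * R"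
    if "i < n" "p < n" for i p
    using block_kron_one_times(2)[OF mult_carrier_mat[OF L(1,2)] R that]
    by (simp add: leg23_def block_leg12_leg13[OF R that])
  moreover have "block (n * n) (leg23 n R * leg12 n R) i p = R * (block n R i p \<otimes>\<^sub>m 1\<^sub>m n)"
    if "i < n" "p < n" for i p
    using block_kron_one_times(1)[OF L(1) R that] by (simp add: leg23_def block_leg12[OF R that])
  ultimately show ?thesis by simp
qed

text \<open>
  \<^const>\<open>mat_inverse\<close> fails only outside the unit group of the matrix ring. A two-sided inverse in
  the sense of \<^const>\<open>invertible_mat\<close> is automatically square of the same size, by comparing
  column counts in the two product equations, so it witnesses membership in that group.
\<close>

lemma mat_inverse_invertible:
  fixes R :: "'k :: field mat"
  assumes R: "R \<in> carrier_mat n n" and "invertible_mat R"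
  shows "the (mat_inverse R) \<in> carrier_mat n n"
    and "R * the (mat_inverse R) = 1\<^sub>m n" and "the (mat_inverse R) * R = 1\<^sub>m n"
proof -
  obtain B where B: "R * B = 1\<^sub>m n" "B * R = 1\<^sub>m (dim_row B)"
    using assms by (auto simp: invertible_mat_def inverts_mat_def)
  have "dim_row B = n" "dim_col B = n"
    using arg_cong[OF B(2), of dim_col] arg_cong[OF B(1), of dim_col] R by auto
  with B have "R \<in> Units (ring_mat TYPE('k) n ())"
    using R by (auto simp: Units_def ring_mat_def)
  with mat_inverse(1)[OF R, of "()"] obtain C where "mat_inverse R = Some C"
    by (cases "mat_inverse R") auto
  with mat_inverse(2)[OF R this]
  show "the (mat_inverse R) \<in> carrier_mat n n"
    and "R * the (mat_inverse R) = 1\<^sub>m n" and "the (mat_inverse R) * R = 1\<^sub>m n" by auto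
qed

lemma mult_eq_iff_eq_mult_inverse:
  fixes X Y :: "'a :: semiring_1 mat"
  assumes "X \<in> carrier_mat m n" "Y \<in> carrier_mat m n"
    and "R \<in> carrier_mat n n" "Q \<in> carrier_mat n n" "R * Q = 1\<^sub>m n" "Q * R = 1\<^sub>m n"
  shows "X * R = Y \<longleftrightarrow> X = Y * Q"
  using assms assoc_mult_mat[OF assms(1,3,4)] assoc_mult_mat[OF assms(2,4,3)] by auto

theorem proposition3p4:
  fixes n :: nat
    and R :: "'k :: field mat"
    and A :: "nat \<Rightarrow> nat \<Rightarrow> 'k mat"
  assumes "n > 0"
    and "R \<in> carrier_mat (n * n) (n * n)"
    and "\<And>i j. i < n \<Longrightarrow> j < n \<Longrightarrow> A i j \<in> carrier_mat n n"
    and "R = finsum_mat TYPE('k) (n * n) (n * n)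
           (\<lambda>(i, j). unit_mat n i j \<otimes>\<^sub>m A i j) ({0..<n} \<times> {0..<n})"
    and "invertible_mat R"
  shows "pentagon_solution n R \<longleftrightarrow>
    (\<forall>i<n. \<forall>p<n.
      finsum_mat TYPE('k) (n * n) (n * n) (\<lambda>j. A i j \<otimes>\<^sub>m A j p) {0..<n}
        = R * (A i p \<otimes>\<^sub>m 1\<^sub>m n) * the (mat_inverse R))"
proof -
  note R = assms(2) and A = assms(3)
  note inv = mat_inverse_invertible[OF R assms(5)]
  let ?S = "\<lambda>i p. finsum_mat TYPE('k) (n * n) (n * n) (\<lambda>j. A i j \<otimes>\<^sub>m A j p) {0..<n}"
  have blk: "block n R i j = A i j" if "i < n" "j < n" for i j
    using block_finsum_unit_mat[of n A n, OF A that] unfolding assms(4)[symmetric] by simp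
  have S: "?S i p \<in> carrier_mat (n * n) (n * n)" if "i < n" "p < n" for i p
    by (rule finsum_mat_closed) (use A that in auto)
  have "finsum_mat TYPE('k) (n * n) (n * n) (\<lambda>j. block n R i j \<otimes>\<^sub>m block n R j p) {0..<n} = ?S i p"
    if "i < n" "p < n" for i p
    by (rule finsum_mat_cong) (use that A blk in auto)
  then have "pentagon_solution n R \<longleftrightarrow>
      (\<forall>i<n. \<forall>p<n. ?S i p * R = R * (A i p \<otimes>\<^sub>m 1\<^sub>m n))"
    unfolding pentagon_solution_iff_blocks[OF R] by (simp add: blk)
  moreover have "?S i p * R = R * (A i p \<otimes>\<^sub>m 1\<^sub>m n) \<longleftrightarrow>
      ?S i p = R * (A i p \<otimes>\<^sub>m 1\<^sub>m n) * the (mat_inverse R)" if "i < n" "p < n" for i p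
    using that A by (intro mult_eq_iff_eq_mult_inverse[OF S _ R inv] mult_carrier_mat[OF R]) auto
  ultimately show ?thesis by simp
qed

end
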